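(* Let $s=(s_0,s_1,s_2)\in\mathbb{R}_+^3$. For every integer $n>1$, the $\ell_\infty$ diameter of $P_n(s)$ is greater than $(s_1+s_2)\lfloor n/2\rfloor^2/4$.
   Context: $\mathbb{R}_+=(0,\infty)$. Let $\omega=e^{2\pi i/3}$ and $\mathbb{L}=\mathbb{Z}+\mathbb{Z}\omega\subset\mathbb{C}$. For a positive integer $n$, let $\mathbb{T}_n=\mathbb{L}/n\mathbb{L}$, with vertex set $V(\mathbb{T}_n)$ of $n^2$ elements. For $z\in\{1,\omega,\omega^2\}$ consider the lattice rhombi $\{a,b,c,d\}$ of side $1$ with $a\in\mathbb{L}$, $b=a+z$, $c=a+z-z\omega^2$, $d=a-z\omega^2$ (so the angle at $a$ and $c$ is $\pi/3$). For $z=1,\omega,\omega^2$ respectively these rhombi form the sets $E_0(\mathbb{L}),E_1(\mathbb{L}),E_2(\mathbb{L})$, and $E_i(\mathbb{T}_n)$ is the set of their images in $\mathbb{T}_n$. For $x:V(\mathbb{T}_n)\to\mathbb{R}$ the discrete hessian is $\nabla^2x(\{a,b,c,d\})=-x(a)+x(b)-x(c)+x(d)$. For $s\in\mathbb{R}_+^3$, write $\nabla^2 x\preccurlyeq s$ if $\nabla^2x(e)\le s_i$ for every $e\in E_i(\mathbb{T}_n)$, $i=0,1,2$. $P_n(s)$ is the bounded polytope of all $x:V(\mathbb{T}_n)\to\mathbb{R}$ with $\sum_{v\in V(\mathbb{T}_n)}x(v)=0$ and $\nabla^2x\preccurlyeq s$. Its $\ell_\infty$ diameter is $\sup_{x,y\in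 P_n(s)}\max_{v}|x(v)-y(v)|$. *)

theory Defs
  imports Complex_Main "HOL-Library.FuncSet"
begin

definition \<omega> :: complex where
  "\<omega> = exp (2 * of_real pi * \<i> / 3)"

definition lattice_L :: "complex set" where
  "lattice_L = {of_int p + of_int q * \<omega> | p q. True}"

definition torus_rel :: "nat \<Rightarrow> (complex \<times> complex) set" where
  "torus_rel n = {(u, v). u \<in> lattice_L \<and> v \<in> lattice_L \<and>
     (\<exists>w\<in>lattice_L. u - v = of_nat n * w)}"

definition torus_V :: "nat \<Rightarrow> complex set set" where
  "torus_V n = lattice_L // torus_rel n"

definition torus_proj :: "nat \<Rightarrow> complex \<Rightarrow> complex set" where
  "torus_proj n a = torus_rel n `` {a}"

text \<open>
  A rhombus is recorded as the quadruple of its vertices \<open>(a, b, c, d)\<close>, acute corners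
  \<open>a\<close> and \<open>c\<close>, rather than as a set. In the torus the set of vertices alone need not
  determine which corners are the acute ones: for \<open>n = 2\<close> every rhombus of each of the
  three types has all four points of the torus as its vertices.
\<close>

definition rhombi_L :: "nat \<Rightarrow> (complex \<times> complex \<times> complex \<times> complex) set" where
  "rhombi_L i = {(a, b, c, d). a \<in> lattice_L \<and> (let z = \<omega> ^ i in
     b = a + z \<and> c = a + z - z * \<omega>\<^sup>2 \<and> d = a - z * \<omega>\<^sup>2)}"

definition rhombi_torus ::
  "nat \<Rightarrow> nat \<Rightarrow> (complex set \<times> complex set \<times> complex set \<times> complex set) set" where
  "rhombi_torus n i =
     (\<lambda>(a, b, c, d). (torus_proj n a, torus_proj n b, torus_proj n c, torus_proj n d)) `
     rhombi_L i"

fun hessian :: "('v \<Rightarrow> real) \<Rightarrow> 'v \<times> 'v \<times> 'v \<times> 'v \<Rightarrow> real" where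
  "hessian x (a, b, c, d) = - x a + x b - x c + x d"

definition hessian_le :: "nat \<Rightarrow> (complex set \<Rightarrow> real) \<Rightarrow> (nat \<Rightarrow> real) \<Rightarrow> bool" where
  "hessian_le n x s \<longleftrightarrow> (\<forall>i<3. \<forall>e\<in>rhombi_torus n i. hessian x e \<le> s i)"

text \<open>
  Functions on the vertex set are represented by the functions that are
  \<^const>\<open>undefined\<close> off it. A triple \<open>s\<close> is a function on \<^typ>\<open>nat\<close> of which only
  the values at \<open>0, 1, 2\<close> matter.
\<close>

definition hessian_polytope :: "nat \<Rightarrow> (nat \<Rightarrow> real) \<Rightarrow> (complex set \<Rightarrow> real) set" where
  "hessian_polytope n s =
     {x \<in> extensional (torus_V n). (\<Sum>v\<in>torus_V n. x v) = 0 \<and> hessian_le n x s}"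

definition linf_diameter :: "'v set \<Rightarrow> ('v \<Rightarrow> real) set \<Rightarrow> real" where
  "linf_diameter V P = (SUP (x, y)\<in>P \<times> P. Max ((\<lambda>v. \<bar>x v - y v\<bar>) ` V))"

end

theory Submission
  imports Defs
begin

text \<open>
  For the lower bound, \<open>g(t) = r (n - r) / 2\<close> with \<open>r = t mod n\<close> is an \<open>n\<close>-periodic function whose
  second difference is at least \<open>-1\<close>. At \<open>p + q \<omega>\<close>, a function of \<open>q\<close> alone has zero
  hessian on the rhombi of types \<open>0\<close> and \<open>1\<close> and minus its second difference on those of type \<open>2\<close>;
  a function of \<open>p - q\<close> alone does the same with type \<open>1\<close> in place of type \<open>2\<close>. So
  \<open>s\<^sub>1 g(p - q) + s\<^sub>2 g(q)\<close> satisfies the constraints, and so do its translates. With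
  \<open>m = n div 2\<close>, the difference of this function and its translate by \<open>2 m + m \<omega>\<close>
  takes the two values \<open>A\<close> and \<open>-A\<close>, where \<open>A = (s\<^sub>1 + s\<^sub>2) m (n - m) / 2\<close>; hence it
  has supremum norm at least \<open>A\<close> even after both functions are normalised to have sum \<open>0\<close>.

  The diameter is a supremum of reals, so the polytope must also be shown to be bounded.
  Suitable rhombi of types \<open>1\<close>, \<open>2\<close> (or \<open>0\<close>, \<open>1\<close>) share an edge whose contributions cancel in the
  sum of the two hessians, which leaves minus the second difference along a lattice line. A
  periodic function with second difference bounded below has bounded oscillation.
\<close>

section \<open>Integer coordinates on the lattice and on the torus\<close>

definition lattice_point :: "int \<Rightarrow> int \<Rightarrow> complex" where
  "lattice_point p q = of_int p + of_int q * \<omega>"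

definition torus_point :: "nat \<Rightarrow> int \<Rightarrow> int \<Rightarrow> complex set" where
  "torus_point n p q = torus_proj n (lattice_point p q)"

lemma omega_eq: "\<omega> = Complex (- 1 / 2) (sqrt 3 / 2)"
proof -
  have "\<omega> = cis (2 * pi / 3)"
    unfolding \<omega>_def cis_conv_exp by (simp add: mult_ac)
  then show ?thesis
    by (simp add: complex_eq_iff cos_120 sin_120 del: times_divide_eq_left)
qed

lemma omega_power2: "\<omega>\<^sup>2 = - 1 - \<omega>"
  by (simp add: omega_eq complex_eq_iff power2_eq_square)

lemma lattice_point_eq_iff: "lattice_point p q = lattice_point p' q' \<longleftrightarrow> p = p' \<and> q = q'"
  by (auto simp: lattice_point_def omega_eq complex_eq_iff)

lemma lattice_L_eq: "lattice_L = {lattice_point p q | p q. True}"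
  by (simp add: lattice_L_def lattice_point_def)

lemma lattice_point_in_L: "lattice_point p q \<in> lattice_L"
  by (auto simp: lattice_L_eq)

text \<open>Congruence splits into coordinates because \<open>1\<close> and \<open>\<omega>\<close>
  are linearly independent over the reals.\<close>

lemma torus_rel_iff:
  "(lattice_point p q, lattice_point p' q') \<in> torus_rel n
     \<longleftrightarrow> int n dvd p - p' \<and> int n dvd q - q'"
proof -
  have "lattice_point p q - lattice_point p' q' = of_nat n * lattice_point i j
      \<longleftrightarrow> p - p' = int n * i \<and> q - q' = int n * j" for i j
  proof -
    have "lattice_point p q - lattice_point p' q' = lattice_point (p - p') (q - q')"
      "of_nat n * lattice_point i j = lattice_point (int n * i) (int n * j)"
      by (simp_all add: lattice_point_def algebra_simps)
    then show ?thesis by (simp add: lattice_point_eq_iff)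
  qed
  then show ?thesis
    unfolding torus_rel_def using lattice_point_in_L
    by (fastforce simp: lattice_L_eq dvd_def)
qed

lemma equiv_torus_rel: "equiv lattice_L (torus_rel n)"
proof (rule equivI)
  show "torus_rel n \<subseteq> lattice_L \<times> lattice_L" by (auto simp: torus_rel_def)
  show "refl_on lattice_L (torus_rel n)"
    by (auto simp: refl_on_def lattice_L_eq torus_rel_iff)
  have rel: "\<exists>p q p' q'. u = lattice_point p q \<and> v = lattice_point p' q'"
    if "(u, v) \<in> torus_rel n" for u v
    using that by (auto simp: torus_rel_def lattice_L_eq)
  show "sym (torus_rel n)"
  proof (rule symI)
    fix u v assume uv: "(u, v) \<in> torus_rel n"
    with rel obtain p q p' q' where "u = lattice_point p q" "v = lattice_point p' q'" by blast
    with uv show "(v, u) \<in> torus_rel n" by (simp add: torus_rel_iff dvd_diff_commute)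
  qed
  show "trans (torus_rel n)"
  proof (rule transI)
    fix u v w assume uv: "(u, v) \<in> torus_rel n" and vw: "(v, w) \<in> torus_rel n"
    from rel[OF uv] rel[OF vw] obtain p q p' q' p'' q'' where
      "u = lattice_point p q" "v = lattice_point p' q'" "w = lattice_point p'' q''" by blast
    with uv vw show "(u, w) \<in> torus_rel n"
      using dvd_add[of "int n" "p - p'" "p' - p''"] dvd_add[of "int n" "q - q'" "q' - q''"]
      by (simp add: torus_rel_iff)
  qed
qed

lemma torus_point_eq_iff:
  "torus_point n p q = torus_point n p' q' \<longleftrightarrow> int n dvd p - p' \<and> int n dvd q - q'"
  unfolding torus_point_def torus_proj_def
  using eq_equiv_class_iff[OF equiv_torus_rel lattice_point_in_L lattice_point_in_L]
  by (simp add: torus_rel_iff)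

lemma torus_V_eq: "torus_V n = {torus_point n p q | p q. True}"
  by (auto simp: torus_V_def quotient_def torus_point_def torus_proj_def lattice_L_eq)

lemma torus_point_in_V: "torus_point n p q \<in> torus_V n"
  by (auto simp: torus_V_eq)

lemma finite_torus_V:
  assumes "n > 0"
  shows "finite (torus_V n)"
proof (rule finite_subset)
  show "torus_V n \<subseteq> (\<lambda>(p, q). torus_point n p q) ` ({0..<int n} \<times> {0..<int n})"
  proof
    fix v assume "v \<in> torus_V n"
    then obtain p q where "v = torus_point n p q" by (auto simp: torus_V_eq)
    moreover have "torus_point n p q = torus_point n (p mod int n) (q mod int n)"
      by (simp add: torus_point_eq_iff)
    ultimately show "v \<in> (\<lambda>(p, q). torus_point n p q) ` ({0..<int n} \<times> {0..<int n})"
      using assms by auto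
  qed
qed simp

section \<open>The hessian constraints in coordinates\<close>

text \<open>\<open>\<omega> ^ 0\<close> and \<open>\<omega> ^ 1\<close> stay unevaluated so that the
  equations rewrite \<open>rhombi_L\<close> directly; the corner \<open>c\<close> takes two of them
  in turn.\<close>

lemma rhombus_vertices:
  "lattice_point p q + \<omega> ^ 0 = lattice_point (p + 1) q"
  "lattice_point p q - \<omega> ^ 0 * \<omega>\<^sup>2 = lattice_point (p + 1) (q + 1)"
  "lattice_point p q + \<omega> ^ 1 = lattice_point p (q + 1)"
  "lattice_point p q - \<omega> ^ 1 * \<omega>\<^sup>2 = lattice_point (p - 1) q"
  "lattice_point p q + \<omega>\<^sup>2 = lattice_point (p - 1) (q - 1)"
  "lattice_point p q - \<omega>\<^sup>2 * \<omega>\<^sup>2 = lattice_point p (q - 1)"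
proof -
  have 3: "\<omega> * \<omega>\<^sup>2 = 1"
    by (simp add: omega_eq complex_eq_iff power2_eq_square)
  have 4: "\<omega>\<^sup>2 * \<omega>\<^sup>2 = \<omega>"
    using 3 by (metis mult.assoc mult.right_neutral power2_eq_square)
  show
    "lattice_point p q + \<omega> ^ 0 = lattice_point (p + 1) q"
    "lattice_point p q - \<omega> ^ 0 * \<omega>\<^sup>2 = lattice_point (p + 1) (q + 1)"
    "lattice_point p q + \<omega> ^ 1 = lattice_point p (q + 1)"
    "lattice_point p q - \<omega> ^ 1 * \<omega>\<^sup>2 = lattice_point (p - 1) q"
    "lattice_point p q + \<omega>\<^sup>2 = lattice_point (p - 1) (q - 1)"
    "lattice_point p q - \<omega>\<^sup>2 * \<omega>\<^sup>2 = lattice_point p (q - 1)"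
    unfolding power_0 power_one_right mult_1 3 4
    by (simp_all add: omega_power2 lattice_point_def algebra_simps)
qed

lemma hessian_le_iff:
  "hessian_le n x s \<longleftrightarrow>
    (\<forall>p q. - x (torus_point n p q) + x (torus_point n (p + 1) q)
           - x (torus_point n (p + 2) (q + 1)) + x (torus_point n (p + 1) (q + 1)) \<le> s 0) \<and>
    (\<forall>p q. - x (torus_point n p q) + x (torus_point n p (q + 1))
           - x (torus_point n (p - 1) (q + 1)) + x (torus_point n (p - 1) q) \<le> s 1) \<and>
    (\<forall>p q. - x (torus_point n p q) + x (torus_point n (p - 1) (q - 1))
           - x (torus_point n (p - 1) (q - 2)) + x (torus_point n p (q - 1)) \<le> s 2)"
proof -
  have ball: "(\<forall>e\<in>rhombi_torus n i. hessian x e \<le> s i) \<longleftrightarrow>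
    (\<forall>p q. hessian x (torus_proj n (lattice_point p q),
      torus_proj n (lattice_point p q + \<omega> ^ i),
      torus_proj n (lattice_point p q + \<omega> ^ i - \<omega> ^ i * \<omega>\<^sup>2),
      torus_proj n (lattice_point p q - \<omega> ^ i * \<omega>\<^sup>2)) \<le> s i)" for i
    unfolding rhombi_torus_def rhombi_L_def Let_def lattice_L_eq by force
  have less_3: "(\<forall>i<3. P i) \<longleftrightarrow> P 0 \<and> P 1 \<and> P 2" for P :: "nat \<Rightarrow> bool"
    by (auto simp: numeral_3_eq_3 numeral_2_eq_2 less_Suc_eq)
  show ?thesis
    unfolding hessian_le_def less_3 ball rhombus_vertices hessian.simps torus_point_def
    by (simp add: add.assoc diff_diff_eq)
qed

section \<open>Boundedness of the polytope\<close>

text \<open>The increment of \<open>g\<close> drops by at most \<open>S\<close> per step, and the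
  increments over a period sum to zero. An increment above \<open>n * S\<close> would keep all those
  of the next period positive, so none exists; fewer than \<open>n\<close> steps lead from
  \<open>b\<close> to a representative of \<open>a\<close>.\<close>

lemma periodic_oscillation_le:
  fixes g :: "int \<Rightarrow> real"
  assumes n: "n > 0" and S: "S \<ge> 0"
    and per: "\<And>t t'. int n dvd t - t' \<Longrightarrow> g t = g t'"
    and conv: "\<And>t. 2 * g (t + 1) - g t - g (t + 2) \<le> S"
  shows "g a - g b \<le> real n * (real n * S)"
proof -
  define d where "d t = g (t + 1) - g t" for t
  have dstep: "d t - real j * S \<le> d (t + int j)" for t j
  proof (induction j)
    case (Suc j)
    have "d (t + int j) - S \<le> d (t + int (Suc j))"
      using conv[of "t + int j"] by (simp add: d_def algebra_simps)
    with Suc show ?case by (simp add: algebra_simps)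
  qed simp
  have dle: "d t \<le> real n * S" for t
  proof -
    have "(\<Sum>j<n. d (t + int j)) = (\<Sum>j<n. g (t + int (Suc j)) - g (t + int j))"
      by (simp add: d_def algebra_simps)
    also have "\<dots> = g (t + int n) - g t"
      using sum_lessThan_telescope[of "\<lambda>j. g (t + int j)" n] by simp
    also have "\<dots> = 0" using per[of "t + int n" t] by simp
    finally have sum_d: "(\<Sum>j<n. d (t + int j)) = 0" .
    have "real n * (d t - real n * S) = (\<Sum>j<n. d t - real n * S)" by simp
    also have "\<dots> \<le> (\<Sum>j<n. d (t + int j))"
    proof (rule sum_mono)
      fix j assume "j \<in> {..<n}"
      then have "real j * S \<le> real n * S" using S by (intro mult_right_mono) auto
      then show "d t - real n * S \<le> d (t + int j)" using dstep[of t j] by linarith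
    qed
    finally show ?thesis using n sum_d by (simp add: mult_le_0_iff)
  qed
  have gle: "g (b + int j) \<le> g b + real j * (real n * S)" for j
  proof (induction j)
    case (Suc j)
    then show ?case using dle[of "b + int j"] by (simp add: d_def algebra_simps)
  qed simp
  define j where "j = nat ((a - b) mod int n)"
  have j: "int j = (a - b) mod int n" "j < n" using n by (simp_all add: j_def nat_less_iff)
  have "int n dvd a - (b + int j)"
    by (simp add: j(1) diff_diff_eq[symmetric])
  then have "g a = g (b + int j)" by (rule per)
  moreover have "real j * (real n * S) \<le> real n * (real n * S)"
    using j(2) S by (intro mult_right_mono) auto
  ultimately show ?thesis using gle[of j] by linarith
qed

lemma hessian_oscillation_le:
  assumes n: "n > 0" and s: "\<forall>i<3. s i > 0" and x: "hessian_le n x s"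
    and v: "v \<in> torus_V n" and w: "w \<in> torus_V n"
  shows "x v - x w \<le> real n * (real n * (s 0 + s 1)) + real n * (real n * (s 1 + s 2))"
proof -
  define X where "X p q = x (torus_point n p q)" for p q
  have per: "X p q = X p' q'" if "int n dvd p - p'" "int n dvd q - q'" for p q p' q'
    using that unfolding X_def by (metis torus_point_eq_iff)
  have h0: "- X p q + X (p + 1) q - X (p + 2) (q + 1) + X (p + 1) (q + 1) \<le> s 0"
    and h1: "- X p q + X p (q + 1) - X (p - 1) (q + 1) + X (p - 1) q \<le> s 1"
    and h2: "- X p q + X (p - 1) (q - 1) - X (p - 1) (q - 2) + X p (q - 1) \<le> s 2" for p q
    using x by (simp_all add: hessian_le_iff X_def)
  have s': "s 0 > 0" "s 1 > 0" "s 2 > 0" using s by auto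
  have p_line: "X a q - X b q \<le> real n * (real n * (s 0 + s 1))" for a b q
  proof (rule periodic_oscillation_le[OF n])
    show "2 * X (t + 1) q - X t q - X (t + 2) q \<le> s 0 + s 1" for t
      \<comment> \<open>The two rhombi share the edge from \<open>(t + 1, q + 1)\<close> to
        \<open>(t + 2, q + 1)\<close>, which cancels.\<close>
      using h0[of t q] h1[of "t + 2" q] by (simp add: algebra_simps)
  qed (use s' per in auto)
  have q_line: "X p a - X p b \<le> real n * (real n * (s 1 + s 2))" for a b p
  proof (rule periodic_oscillation_le[OF n])
    show "2 * X p (t + 1) - X p t - X p (t + 2) \<le> s 1 + s 2" for t
      \<comment> \<open>The shared edge runs from \<open>(p - 1, t)\<close> to
        \<open>(p - 1, t + 1)\<close>.\<close>
      using h1[of p t] h2[of p "t + 2"] by (simp add: algebra_simps)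
  qed (use s' per in auto)
  from v w obtain p q p' q' where "v = torus_point n p q" "w = torus_point n p' q'"
    by (auto simp: torus_V_eq)
  then show ?thesis using p_line[of p q p'] q_line[of p' q q'] by (simp add: X_def)
qed

text \<open>A zero sum forces both a nonpositive and a nonnegative value; \<open>x v\<close> is
  compared with each.\<close>

lemma abs_le_oscillation:
  fixes x :: "'a \<Rightarrow> real"
  assumes V: "finite V" and v: "v \<in> V" and sum0: "(\<Sum>v\<in>V. x v) = 0"
    and osc: "\<And>v w. v \<in> V \<Longrightarrow> w \<in> V \<Longrightarrow> x v - x w \<le> D"
  shows "\<bar>x v\<bar> \<le> D"
proof -
  have "\<exists>w\<in>V. x w \<le> 0"
    using sum_pos[of V x] V v sum0 by (metis empty_iff less_irrefl not_le)
  then have "x v \<le> D" using osc[OF v] by force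
  moreover have "\<exists>w\<in>V. x w \<ge> 0"
    using sum_pos[of V "\<lambda>w. - x w"] V v sum0
    by (metis empty_iff less_irrefl neg_0_less_iff_less not_le sum_negf)
  then have "- x v \<le> D" using osc[OF _ v] by force
  ultimately show ?thesis by simp
qed

lemma bdd_above_linf_diameter:
  assumes n: "n > 0" and s: "\<forall>i<3. s i > 0"
  shows "bdd_above ((\<lambda>(x, y). Max ((\<lambda>v. \<bar>x v - y v\<bar>) ` torus_V n))
           ` (hessian_polytope n s \<times> hessian_polytope n s))"
proof -
  define D where "D = real n * (real n * (s 0 + s 1)) + real n * (real n * (s 1 + s 2))"
  have fin: "finite (torus_V n)" by (rule finite_torus_V[OF n])
  have ne: "torus_V n \<noteq> {}" using torus_point_in_V by blast
  have bound: "\<bar>x v\<bar> \<le> D" if "x \<in> hessian_polytope n s" "v \<in> torus_V n" for x v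
    using that abs_le_oscillation[OF fin] hessian_oscillation_le[OF n s]
    unfolding hessian_polytope_def D_def by blast
  have "Max ((\<lambda>v. \<bar>x v - y v\<bar>) ` torus_V n) \<le> 2 * D"
    if "x \<in> hessian_polytope n s" "y \<in> hessian_polytope n s" for x y
  proof (rule Max.boundedI)
    fix r assume "r \<in> (\<lambda>v. \<bar>x v - y v\<bar>) ` torus_V n"
    then obtain v where "v \<in> torus_V n" "r = \<bar>x v - y v\<bar>" by blast
    with bound[OF that(1)] bound[OF that(2)] show "r \<le> 2 * D" by fastforce
  qed (use fin ne in auto)
  then show ?thesis by (intro bdd_aboveI[where M = "2 * D"]) auto
qed

text \<open>Boundedness enters here: it makes the real supremum an upper bound of the
  distances.\<close>

lemma linf_diameter_ge:
  assumes n: "n > 0" and s: "\<forall>i<3. s i > 0" and v: "v \<in> torus_V n"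
    and x: "x \<in> hessian_polytope n s" and y: "y \<in> hessian_polytope n s"
  shows "\<bar>x v - y v\<bar> \<le> linf_diameter (torus_V n) (hessian_polytope n s)"
proof -
  have "\<bar>x v - y v\<bar> \<le> Max ((\<lambda>v. \<bar>x v - y v\<bar>) ` torus_V n)"
    using v finite_torus_V[OF n] by (intro Max_ge) auto
  also have "\<dots> \<le> linf_diameter (torus_V n) (hessian_polytope n s)"
    unfolding linf_diameter_def
    using cSUP_upper[OF _ bdd_above_linf_diameter[OF n s], of "(x, y)"] x y by simp
  finally show ?thesis .
qed

section \<open>Points of the polytope from periodic functions\<close>

text \<open>The coefficients of a hessian sum to zero, so subtracting the mean \<open>c\<close>
  preserves the constraints.\<close>

lemma hessian_polytope_of_periodic:
  fixes F :: "int \<Rightarrow> int \<Rightarrow> real"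
  assumes n: "n > 0"
    and per: "\<And>p q p' q'. int n dvd p - p' \<Longrightarrow> int n dvd q - q' \<Longrightarrow> F p q = F p' q'"
    and h0: "\<And>p q. - F p q + F (p + 1) q - F (p + 2) (q + 1) + F (p + 1) (q + 1) \<le> s 0"
    and h1: "\<And>p q. - F p q + F p (q + 1) - F (p - 1) (q + 1) + F (p - 1) q \<le> s 1"
    and h2: "\<And>p q. - F p q + F (p - 1) (q - 1) - F (p - 1) (q - 2) + F p (q - 1) \<le> s 2"
  obtains x c where "x \<in> hessian_polytope n s" "\<And>p q. x (torus_point n p q) = F p q - c"
proof -
  \<comment> \<open>\<open>SOME\<close> picks arbitrary coordinates of \<open>v\<close>; periodicity
    makes the choice irrelevant.\<close>
  define f where
    "f v = (let (p, q) = (SOME (p, q). v = torus_point n p q) in F p q)" for v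
  have f: "f (torus_point n p q) = F p q" for p q
  proof -
    obtain p' q' where pq: "(SOME (p', q'). torus_point n p q = torus_point n p' q') = (p', q')"
      by fastforce
    have "case (p', q') of (p', q') \<Rightarrow> torus_point n p q = torus_point n p' q'"
      unfolding pq[symmetric] by (rule someI[of _ "(p, q)"]) simp
    then have "F p q = F p' q'" by (intro per) (simp_all add: torus_point_eq_iff)
    then show ?thesis by (simp add: f_def pq)
  qed
  define c where "c = (\<Sum>v\<in>torus_V n. f v) / card (torus_V n)"
  define x where "x = restrict (\<lambda>v. f v - c) (torus_V n)"
  have x: "x (torus_point n p q) = F p q - c" for p q
    by (simp add: x_def f torus_point_in_V)
  have "card (torus_V n) \<noteq> 0"
    using finite_torus_V[OF n] torus_point_in_V by (metis card_0_eq empty_iff)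
  then have "(\<Sum>v\<in>torus_V n. x v) = 0"
    by (simp add: x_def c_def sum_subtractf)
  moreover have "hessian_le n x s"
    unfolding hessian_le_iff x using h0 h1 h2 by (simp add: algebra_simps)
  ultimately have "x \<in> hessian_polytope n s"
    by (simp add: hessian_polytope_def x_def)
  with x show ?thesis by (rule that[rotated])
qed

section \<open>The periodic parabola and the functions built from it\<close>

definition parabola :: "nat \<Rightarrow> int \<Rightarrow> real" where
  "parabola n t = real_of_int ((t mod int n) * (int n - t mod int n)) / 2"

lemma parabola_0 [simp]: "parabola n 0 = 0"
  by (simp add: parabola_def)

lemma parabola_periodic:
  assumes "int n dvd t - t'"
  shows "parabola n t = parabola n t'"
proof -
  have "t mod int n = t' mod int n" using assms by (simp add: mod_eq_dvd_iff)
  then show ?thesis by (simp add: parabola_def)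
qed

text \<open>The right endpoint \<open>t = n\<close> is included, since both sides vanish
  there.\<close>

lemma parabola_eq:
  assumes "0 \<le> t" "t \<le> int n"
  shows "parabola n t = real_of_int (t * (int n - t)) / 2"
  using assms by (cases "t = int n") (simp_all add: parabola_def)

lemma parabola_half:
  "parabola n (int (n div 2)) = real (n div 2) * (real n - real (n div 2)) / 2"
  "parabola n (- int (n div 2)) = real (n div 2) * (real n - real (n div 2)) / 2"
proof -
  have m: "int (n div 2) \<le> int n" by simp
  then show "parabola n (int (n div 2)) = real (n div 2) * (real n - real (n div 2)) / 2"
    by (simp add: parabola_eq del: of_nat_le_iff)
  have "parabola n (- int (n div 2)) = parabola n (int n - int (n div 2))"
    by (rule parabola_periodic) simp
  then show "parabola n (- int (n div 2)) = real (n div 2) * (real n - real (n div 2)) / 2"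
    using m by (simp add: parabola_eq mult.commute del: of_nat_le_iff)
qed

text \<open>If the three points lie on one arc, equality holds. Otherwise the middle one is a
  multiple of \<open>n\<close>, where the parabola vanishes, and the outer values are
  nonnegative.\<close>

lemma parabola_second_difference:
  assumes "n > 1"
  shows "2 * parabola n (t + 1) - parabola n t - parabola n (t + 2) \<le> 1"
proof -
  define r where "r = t mod int n"
  have r: "0 \<le> r" "r < int n" using assms by (simp_all add: r_def)
  have shift: "parabola n (t + k) = parabola n (r + k)" for k
    by (rule parabola_periodic) (simp add: r_def)
  have v0: "parabola n t = real_of_int (r * (int n - r)) / 2"
    using shift[of 0] parabola_eq[of r n] r by simp
  have v1: "parabola n (t + 1) = real_of_int ((r + 1) * (int n - (r + 1))) / 2"
    using shift[of 1] parabola_eq[of "r + 1" n] r by simp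
  show ?thesis
  proof (cases "r + 2 \<le> int n")
    case True
    then have "parabola n (t + 2) = real_of_int ((r + 2) * (int n - (r + 2))) / 2"
      using shift[of 2] parabola_eq[of "r + 2" n] r by simp
    with v0 v1 show ?thesis by (simp add: algebra_simps)
  next
    case False
    then have r': "r = int n - 1" using r by linarith
    have "0 \<le> (t + 2) mod int n" "(t + 2) mod int n \<le> int n"
      using assms by (simp_all add: order_less_imp_le)
    then have "parabola n (t + 2) \<ge> 0"
      unfolding parabola_def by (intro divide_nonneg_pos of_int_nonneg mult_nonneg_nonneg) simp_all
    with v0 v1 r' show ?thesis using assms by simp
  qed
qed

text \<open>Translation by \<open>2 m + m \<omega>\<close> shifts both \<open>p - q\<close> and
  \<open>q\<close> by \<open>m\<close>. The final proof compares the shifts \<open>0\<close> and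
  \<open>n div 2\<close>.\<close>

lemma parabola_in_hessian_polytope:
  assumes n: "n > 1" and s: "\<forall>i<3. s i > 0"
  obtains x c where "x \<in> hessian_polytope n s"
    "\<And>p q. x (torus_point n p q)
       = s 1 * parabola n (p - q - m) + s 2 * parabola n (q - m) - c"
proof (rule hessian_polytope_of_periodic
    [of n "\<lambda>p q. s 1 * parabola n (p - q - m) + s 2 * parabola n (q - m)" s])
  have s': "s 0 > 0" "s 1 > 0" "s 2 > 0" using s by auto
  have conv: "s i * (2 * parabola n (t + 1) - parabola n t - parabola n (t + 2)) \<le> s i"
    if "s i > 0" for i t
    using mult_left_mono[OF parabola_second_difference[OF n], of "s i" t] that by simp
  show "s 1 * parabola n (p - q - m) + s 2 * parabola n (q - m)
      = s 1 * parabola n (p' - q' - m) + s 2 * parabola n (q' - m)"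
    if "int n dvd p - p'" "int n dvd q - q'" for p q p' q'
  proof -
    have "int n dvd p - q - m - (p' - q' - m)" "int n dvd q - m - (q' - m)"
      using dvd_diff[OF that] that(2) by (simp_all add: algebra_simps)
    then show ?thesis using parabola_periodic by metis
  qed
  show "- (s 1 * parabola n (p - q - m) + s 2 * parabola n (q - m))
      + (s 1 * parabola n (p + 1 - q - m) + s 2 * parabola n (q - m))
      - (s 1 * parabola n (p + 2 - (q + 1) - m) + s 2 * parabola n (q + 1 - m))
      + (s 1 * parabola n (p + 1 - (q + 1) - m) + s 2 * parabola n (q + 1 - m)) \<le> s 0" for p q
    using s' by (simp add: algebra_simps)
  show "- (s 1 * parabola n (p - q - m) + s 2 * parabola n (q - m))
      + (s 1 * parabola n (p - (q + 1) - m) + s 2 * parabola n (q + 1 - m))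
      - (s 1 * parabola n (p - 1 - (q + 1) - m) + s 2 * parabola n (q + 1 - m))
      + (s 1 * parabola n (p - 1 - q - m) + s 2 * parabola n (q - m)) \<le> s 1" for p q
    \<comment> \<open>The terms in \<open>q\<close> cancel; those in \<open>p - q\<close> form a
      second difference centred at \<open>p - q - m - 1\<close>.\<close>
    using conv[OF s'(2), of "p - q - m - 2"] by (simp add: algebra_simps)
  show "- (s 1 * parabola n (p - q - m) + s 2 * parabola n (q - m))
      + (s 1 * parabola n (p - 1 - (q - 1) - m) + s 2 * parabola n (q - 1 - m))
      - (s 1 * parabola n (p - 1 - (q - 2) - m) + s 2 * parabola n (q - 2 - m))
      + (s 1 * parabola n (p - (q - 1) - m) + s 2 * parabola n (q - 1 - m)) \<le> s 2" for p q
    using conv[OF s'(3), of "q - m - 2"] by (simp add: algebra_simps)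
qed (use n that in auto)

theorem lemma4p1:
  fixes s :: "nat \<Rightarrow> real" and n :: nat
  assumes "\<forall>i<3. s i > 0" and "n > 1"
  shows "linf_diameter (torus_V n) (hessian_polytope n s)
           > (s 1 + s 2) * (real_of_int \<lfloor>real n / 2\<rfloor>)\<^sup>2 / 4"
proof -
  define m where "m = n div 2"
  define B where "B = real m * (real n - real m) / 2"
  define A where "A = (s 1 + s 2) * B"
  have n: "n > 0" using assms(2) by simp
  have S: "s 1 + s 2 > 0" using assms(1) by (simp add: add_pos_pos)
  obtain x c where x: "x \<in> hessian_polytope n s" "\<And>p q. x (torus_point n p q)
       = s 1 * parabola n (p - q - 0) + s 2 * parabola n (q - 0) - c"
    using parabola_in_hessian_polytope[OF assms(2,1)] by blast
  obtain y c' where y: "y \<in> hessian_polytope n s" "\<And>p q. y (torus_point n p q)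
       = s 1 * parabola n (p - q - int m) + s 2 * parabola n (q - int m) - c'"
    using parabola_in_hessian_polytope[OF assms(2,1)] by blast
  note half = parabola_half[of n, folded m_def, folded B_def]
  have "x (torus_point n 0 0) - y (torus_point n 0 0) = - A - c + c'"
    by (simp add: x(2) y(2) half A_def distrib_right)
  moreover have "x (torus_point n (2 * int m) (int m)) - y (torus_point n (2 * int m) (int m))
      = A - c + c'"
    by (simp add: x(2) y(2) half A_def distrib_right)
  \<comment> \<open>The two differences are \<open>2 * A\<close> apart, so one has absolute value at
    least \<open>A\<close>, whatever the normalising constants \<open>c\<close> and
    \<open>c'\<close> are.\<close>
  ultimately have "A \<le> linf_diameter (torus_V n) (hessian_polytope n s)"
    using linf_diameter_ge[OF n assms(1) torus_point_in_V x(1) y(1), of 0 0]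
      linf_diameter_ge[OF n assms(1) torus_point_in_V x(1) y(1), of "2 * int m" "int m"]
    by linarith
  moreover have "(s 1 + s 2) * (real_of_int \<lfloor>real n / 2\<rfloor>)\<^sup>2 / 4 < A"
  proof -
    have m: "real m > 0" "2 * real m \<le> real n" using assms(2) by (auto simp: m_def)
    have "real_of_int \<lfloor>real n / 2\<rfloor> = real m"
      using floor_divide_of_nat_eq[where ?'a = real, of n 2] by (simp add: m_def)
    \<comment> \<open>From \<open>2 * m \<le> n\<close> follows \<open>B \<ge> m * m / 2\<close>;
      strictness comes from \<open>m > 0\<close>.\<close>
    moreover have "(real m)\<^sup>2 / 4 < B"
    proof -
      have "real m * real m \<le> real m * (real n - real m)"
        using m by (intro mult_left_mono) auto
      then show ?thesis using mult_pos_pos[OF m(1) m(1)] by (simp add: B_def power2_eq_square)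
    qed
    ultimately show ?thesis
      using mult_strict_left_mono[of "(real m)\<^sup>2 / 4" B, OF _ S] by (simp add: A_def)
  qed
  ultimately show ?thesis by linarith
qed

end
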